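(* Let $k\ge2$, let $Q=(Q_1,\dots,Q_k)$ be a probability distribution on $\{1,\dots,k\}$ with $Q_i>0$ for all $i$, let $Y\sim Q$, and let $\hat z$ be a random vector in $\mathbb{R}^k$ (the logit prediction), independent of $Y$, such that $\mathbb{E}[\hat z]$ and $\mathbb{E}[\mathrm{LSE}(\hat z)]$ exist. Then $$\mathbb{E}\left[-\ln\mathrm{sm}_Y(\hat z)\right]=H(Q)+\mathbb{B}_{\mathrm{LSE}}\left[\hat z\right]+d_{\mathrm{LSE}}\left(\mathrm{sm}^{-1}(Q),\mathbb{E}[\hat z]\right).$$
   Context: $\mathrm{LSE}(x_1,\dots,x_k)=\ln\sum_{i=1}^k e^{x_i}$ is the LogSumExp function and $\mathrm{sm}=\nabla\mathrm{LSE}$ is the softmax function with components $\mathrm{sm}_i(x)=e^{x_i}/\sum_{j=1}^k e^{x_j}$. $\mathrm{sm}^{-1}(p)=\left(\ln\frac{p_1}{p_k},\dots,\ln\frac{p_{k-1}}{p_k},0\right)^\intercal$ for a probability vector $p$ with positive entries. $H(Q)=-\sum_{i=1}^k Q_i\ln Q_i$ is the Shannon entropy. For a differentiable convex $\phi$ on $\mathbb{R}^k$: $d_\phi(x,y)=\phi(y)-\phi(x)-\langle\nabla\phi(x),y-x\rangle$ (Bregman divergence) and $\mathbb{B}_\phi[X]=\mathbb{E}\left[d_\phi(\mathbb{E}[X],X)\right]=\mathbb{E}[\phi(X)]-\phi(\mathbb{E}[X])$ (Bregman Information). *)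

theory Defs
  imports "HOL-Probability.Probability"
begin

definition LSE :: "real ^ 'k::finite \<Rightarrow> real" where
  "LSE x = ln (\<Sum>i\<in>UNIV. exp (x $ i))"

definition softmax :: "real ^ 'k::finite \<Rightarrow> real ^ 'k" where
  "softmax x = (\<chi> i. exp (x $ i) / (\<Sum>j\<in>UNIV. exp (x $ j)))"

text \<open>The coordinates are indexed by a finite linearly ordered type 'k (playing the role of
  {1,...,k}), so that ``the last coordinate k'' makes sense; it is Max UNIV.\<close>

definition softmax_inv :: "real ^ 'k::{finite,linorder} \<Rightarrow> real ^ 'k::{finite,linorder}" where
  "softmax_inv p = (\<chi> i. if i = Max UNIV then 0 else ln (p $ i / p $ Max UNIV))"

definition shannon_entropy :: "real ^ 'k::finite \<Rightarrow> real" where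
  "shannon_entropy q = - (\<Sum>i\<in>UNIV. q $ i * ln (q $ i))"

definition gradient :: "('a::real_inner \<Rightarrow> real) \<Rightarrow> 'a \<Rightarrow> 'a" where
  "gradient f x = (THE D. GDERIV f x :> D)"

text \<open>Argument order: the divergence is linearised at its first argument.\<close>

definition bregman :: "('a::real_inner \<Rightarrow> real) \<Rightarrow> 'a \<Rightarrow> 'a \<Rightarrow> real" where
  "bregman f x y = f y - f x - inner (gradient f x) (y - x)"

definition bregman_info :: "'w measure \<Rightarrow> ('a::euclidean_space \<Rightarrow> real) \<Rightarrow> ('w \<Rightarrow> 'a) \<Rightarrow> real" where
  "bregman_info M f X = integral\<^sup>L M (\<lambda>w. bregman f (integral\<^sup>L M X) (X w))"

text \<open>Independence of two random variables with possibly different value types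
  (\<^const>\<open>prob_space.indep_var\<close> forces both value types to coincide): the generated
  sigma-algebras are independent.\<close>

definition indep_rvs ::
  "'w measure \<Rightarrow> 'a measure \<Rightarrow> ('w \<Rightarrow> 'a) \<Rightarrow> 'b measure \<Rightarrow> ('w \<Rightarrow> 'b) \<Rightarrow> bool" where
  "indep_rvs M S X T Y \<longleftrightarrow>
     X \<in> measurable M S \<and> Y \<in> measurable M T \<and>
     prob_space.indep_set M (sets (vimage_algebra (space M) X S))
                            (sets (vimage_algebra (space M) Y T))"

lemma gradient_eqI:
  assumes "GDERIV f x :> D"
  shows "gradient f x = D"
  unfolding gradient_def
proof (rule the_equality)
  show "GDERIV f x :> D" by fact
  fix E assume "GDERIV f x :> E"
  then have "(\<lambda>h. inner h E) = (\<lambda>h. inner h D)"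
    using assms unfolding gderiv_def by (rule has_derivative_unique)
  then have "inner h E = inner h D" for h by meson
  then have "inner (E - D) (E - D) = 0"
    by (simp add: inner_diff_right)
  then show "E = D" by simp
qed

lemma GDERIV_LSE: "GDERIV LSE x :> softmax (x :: real ^ 'k::finite)"
proof -
  have pos: "(\<Sum>i\<in>UNIV. exp (x $ i)) > 0"
    by (intro sum_pos) auto
  have "((\<lambda>x. ln (\<Sum>i\<in>UNIV. exp (x $ i))) has_derivative
      (\<lambda>h. (\<Sum>i\<in>UNIV. h $ i * exp (x $ i)) * inverse (\<Sum>i\<in>UNIV. exp (x $ i)))) (at x)"
    using pos by (auto intro!: derivative_eq_intros sum.cong bounded_linear_imp_has_derivative simp: field_simps)
  moreover have "(\<Sum>i\<in>UNIV. h $ i * exp (x $ i)) * inverse (\<Sum>i\<in>UNIV. exp (x $ i))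
      = inner h (softmax x)" for h
    by (simp add: inner_vec_def softmax_def sum_distrib_right divide_inverse mult.assoc)
  ultimately show ?thesis
    by (simp add: gderiv_def LSE_def[abs_def])
qed

lemma gradient_LSE: "gradient LSE = softmax"
  by (rule ext) (rule gradient_eqI[OF GDERIV_LSE])

end

theory Submission
  imports Defs
begin

text \<open>Since \<open>- ln (softmax z $ y) = LSE z - z $ y\<close>, independence turns the expected loss into
  \<open>E (LSE Z) - Q \<bullet> E Z\<close>. On the other side, \<open>bregman_info\<close> is the Jensen gap
  \<open>E (LSE Z) - LSE (E Z)\<close>, and since \<open>softmax (softmax_inv Q) = Q\<close>, the Bregman divergence from
  \<open>softmax_inv Q\<close> to \<open>\<mu>\<close> is \<open>LSE \<mu> - Q \<bullet> \<mu> - shannon_entropy Q\<close>: the negative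
  entropy is the convex conjugate of \<open>LSE\<close>.\<close>

lemma sum_exp_pos: "(\<Sum>i\<in>UNIV. exp (x $ i :: real)) > 0" for x :: "real ^ 'k::finite"
  by (intro sum_pos) auto

lemma neg_ln_softmax: "- ln (softmax x $ i) = LSE x - x $ i"
  using sum_exp_pos[of x] by (simp add: softmax_def LSE_def ln_div)

lemma exp_softmax_inv:
  fixes p :: "real ^ 'k::{finite,linorder}"
  assumes "\<And>i. p $ i > 0"
  shows "exp (softmax_inv p $ i) = p $ i / p $ Max UNIV"
  using assms[of i] assms[of "Max UNIV"] by (simp add: softmax_inv_def)

context
  fixes p :: "real ^ 'k::{finite,linorder}"
  assumes pos: "\<And>i. p $ i > 0" and sum1: "(\<Sum>i\<in>UNIV. p $ i) = 1"
begin

lemma sum_exp_softmax_inv: "(\<Sum>i\<in>UNIV. exp (softmax_inv p $ i)) = 1 / p $ Max UNIV"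
  by (simp add: exp_softmax_inv pos sum1 flip: sum_divide_distrib)

lemma softmax_softmax_inv: "softmax (softmax_inv p) = p"
  by (simp add: softmax_def vec_eq_iff sum_exp_softmax_inv) (simp add: exp_softmax_inv pos less_imp_neq[OF pos, symmetric])

text \<open>Softmax ignores adding a constant to all coordinates, so its inverse is the vector of
  logarithms up to a shift. The shift is \<open>- ln (p $ Max UNIV)\<close>, which is the
  \<open>LSE\<close> of the vector itself.\<close>

lemma softmax_inv_nth: "softmax_inv p $ i = ln (p $ i) + LSE (softmax_inv p)"
proof -
  have "softmax_inv p $ i = ln (p $ i / p $ Max UNIV)"
    by (metis exp_softmax_inv[OF pos] ln_exp)
  then show ?thesis
    using pos[of i] pos[of "Max UNIV"] by (simp add: LSE_def sum_exp_softmax_inv ln_div)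
qed

lemma bregman_LSE_softmax_inv:
  "bregman LSE (softmax_inv p) y = LSE y - inner p y - shannon_entropy p"
proof -
  \<comment> \<open>The logarithms average under \<open>p\<close> to the negative entropy; the
    constant shift keeps its value because the weights sum to one.\<close>
  have "inner p (softmax_inv p) = LSE (softmax_inv p) - shannon_entropy p"
    by (subst inner_vec_def)
      (simp add: softmax_inv_nth[of i for i] distrib_left sum.distrib shannon_entropy_def sum1
        flip: sum_distrib_right)
  then show ?thesis
    by (simp add: bregman_def gradient_LSE softmax_softmax_inv inner_diff_right)
qed

end

text \<open>The gradient is taken at the fixed point \<open>E X\<close>, so the linear term is a
  constant vector paired with the centred variable \<open>X - E X\<close> and has mean zero.\<close>

lemma (in prob_space) bregman_info_eq:
  assumes "integrable M X" "integrable M (\<lambda>w. f (X w))"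
  shows "bregman_info M f X = (\<integral>w. f (X w) \<partial>M) - f (\<integral>w. X w \<partial>M)"
  using assms by (simp add: bregman_info_def bregman_def prob_space)

text \<open>Composition only shrinks the generated sigma-algebras. Mapping both variables into the
  common space \<open>N\<close> makes the product rules for \<open>indep_var\<close>
  available.\<close>

lemma (in prob_space) indep_rvs_compose_indep_var:
  assumes ind: "indep_rvs M S X T Y" and f: "f \<in> measurable S N" and g: "g \<in> measurable T N"
  shows "indep_var N (\<lambda>w. f (X w)) N (\<lambda>w. g (Y w))"
proof -
  have X: "X \<in> measurable M S" and Y: "Y \<in> measurable M T"
    and indep: "indep_set (sets (vimage_algebra (space M) X S)) (sets (vimage_algebra (space M) Y T))"
    using ind by (auto simp: indep_rvs_def)
  have sub: "sigma_sets (space M) {(\<lambda>w. h (V w)) -` A \<inter> space M |A. A \<in> sets N}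
      \<subseteq> sets (vimage_algebra (space M) V R)"
    if V: "V \<in> measurable M R" and h: "h \<in> measurable R N" for h V R
  proof -
    have "V \<in> measurable (vimage_algebra (space M) V R) R"
      using measurable_space[OF V] by (intro measurable_vimage_algebra1) auto
    from measurable_sets[OF measurable_compose[OF this h]]
    show ?thesis
      by (subst space_vimage_algebra[symmetric, of "space M" V R], intro sets.sigma_sets_subset) auto
  qed
  show ?thesis
    unfolding indep_var_eq
  proof (intro conjI)
    show "indep_set (sigma_sets (space M) {(\<lambda>w. f (X w)) -` A \<inter> space M |A. A \<in> sets N})
        (sigma_sets (space M) {(\<lambda>w. g (Y w)) -` A \<inter> space M |A. A \<in> sets N})"
      using indep sub[OF X f] sub[OF Y g] unfolding indep_set_def
      by (elim indep_sets_mono_sets) (auto split: bool.split)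
  qed (use X Y f g in measurable)
qed

text \<open>The index is random, so the coordinate is first split over the finitely many values of
  \<open>Y\<close>: each summand multiplies an indicator of \<open>Y\<close> by a fixed coordinate
  of \<open>Z\<close>, two independent integrable real variables.\<close>

lemma (in prob_space) expectation_nth_indep:
  fixes Y :: "'a \<Rightarrow> 'k::finite" and Z :: "'a \<Rightarrow> real ^ 'k" and q :: "'k \<Rightarrow> real"
  assumes q: "\<And>i. q i \<ge> 0"
    and Y: "distributed M (count_space UNIV) Y (\<lambda>i. ennreal (q i))"
    and ind: "indep_rvs M (count_space UNIV) Y borel Z"
    and Z: "integrable M Z"
  shows "integrable M (\<lambda>w. Z w $ Y w)"
    and "expectation (\<lambda>w. Z w $ Y w) = (\<Sum>i\<in>UNIV. q i * expectation Z $ i)"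
proof -
  have Ym [measurable]: "Y \<in> measurable M (count_space UNIV)"
    using ind by (simp add: indep_rvs_def)
  have Zi: "integrable M (\<lambda>w. Z w $ i)" "expectation (\<lambda>w. Z w $ i) = expectation Z $ i" for i
    using integrable_bounded_linear[OF bounded_linear_vec_nth Z]
      integral_bounded_linear[OF bounded_linear_vec_nth Z] by auto
  have prob: "expectation (\<lambda>w. indicator {i} (Y w)) = q i" for i
  proof -
    have "expectation (\<lambda>w. indicator {i} (Y w)) = (\<Sum>j\<in>UNIV. q j * indicator {i} j)"
      using distributed_integral[OF Y, of "indicator {i}"] q
      by (simp add: lebesgue_integral_count_space_finite)
    then show ?thesis by simp
  qed
  have indi: "indep_var borel (\<lambda>w. indicator {i} (Y w) :: real) borel (\<lambda>w. Z w $ i)" for i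
    by (rule indep_rvs_compose_indep_var[OF ind]) measurable
  have int: "integrable M (\<lambda>w. indicator {i} (Y w) :: real)" for i
    by (rule integrable_const_bound[of _ 1]) auto
  have split: "Z w $ Y w = (\<Sum>i\<in>UNIV. indicator {i} (Y w) * Z w $ i)" for w
    by (simp add: indicator_def if_distrib cong: if_cong)
  show "integrable M (\<lambda>w. Z w $ Y w)"
    unfolding split by (intro Bochner_Integration.integrable_sum indep_var_integrable indi int Zi)
  show "expectation (\<lambda>w. Z w $ Y w) = (\<Sum>i\<in>UNIV. q i * expectation Z $ i)"
    unfolding split
    by (subst Bochner_Integration.integral_sum)
      (simp_all only: indep_var_integrable[OF indi int Zi(1)]
        indep_var_lebesgue_integral[OF indi int Zi(1)] prob Zi(2))
qed

theorem corollary3p6: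
  fixes M :: "'w measure"
    and Q :: "real ^ 'k::{finite,linorder}"
    and Y :: "'w \<Rightarrow> 'k"
    and Z :: "'w \<Rightarrow> real ^ 'k::{finite,linorder}"
  assumes "CARD('k) \<ge> 2"
    and "prob_space M"
    and "\<And>i. Q $ i > 0"
    and "(\<Sum>i\<in>UNIV. Q $ i) = 1"
    and "distributed M (count_space UNIV) Y (\<lambda>i. ennreal (Q $ i))"
    and "indep_rvs M (count_space UNIV) Y borel Z"
    and "integrable M Z"
    and "integrable M (\<lambda>w. LSE (Z w))"
  shows "integrable M (\<lambda>w. - ln (softmax (Z w) $ Y w)) \<and>
    integral\<^sup>L M (\<lambda>w. - ln (softmax (Z w) $ Y w)) =
      shannon_entropy Q + bregman_info M LSE Z + bregman LSE (softmax_inv Q) (integral\<^sup>L M Z)"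
proof -
  interpret prob_space M by fact
  have nth: "integrable M (\<lambda>w. Z w $ Y w)"
    "expectation (\<lambda>w. Z w $ Y w) = inner Q (expectation Z)"
    using expectation_nth_indep[of "\<lambda>i. Q $ i" Y Z] assms by (simp_all add: less_imp_le inner_vec_def)
  show ?thesis
    \<comment> \<open>On the right, \<open>LSE (expectation Z)\<close> and the entropy cancel, so
      both sides become \<open>E (LSE Z)\<close> minus
      \<open>inner Q (expectation Z)\<close>.\<close>
    unfolding neg_ln_softmax
    using nth assms by (simp add: bregman_info_eq bregman_LSE_softmax_inv)
qed

end
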